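(* Let $(X,R)$ be a pretree whose shadow topology $\tau_s$ is compact and Hausdorff (for example, a compact median pretree). Then every monotone (not necessarily continuous) function $f:X\to\mathbb{R}$ is fragmented.
   Context: A pretree is a pair $(X,R)$ with $X$ a set and $R$ a ternary relation on $X$ (write $\langle a,b,c\rangle$ for $(a,b,c)\in R$) such that: (B1) $\langle a,b,c\rangle\Rightarrow\langle c,b,a\rangle$; (B2) $\langle a,b,c\rangle\wedge\langle a,c,b\rangle\Leftrightarrow b=c$; (B3) $\langle a,b,c\rangle\Rightarrow\langle a,b,d\rangle\vee\langle d,b,c\rangle$. Put $[u,v]=\{x\in X:\langle u,x,v\rangle\}$. The pretree is a median pretree if $[a,b]\cap[a,c]\cap[b,c]\neq\emptyset$ for all $a,b,c\in X$. The shadow topology $\tau_s$ has as a subbase of closed sets the family of all $S^v_u=\{x\in X:u\in[x,v]\}$, $u,v\in X$, $u\ne v$. A function $f:X\to\mathbb{R}$ is monotone if $\langle u,w,v\rangle$ implies that $f(w)$ lies in the closed interval with endpoints $f(u),f(v)$. A function $f:X\to\mathbb{R}$ on a compact Hausdorff space is fragmented if and only if for every nonempty closed $Y\subseteq X$ the restriction $f|_Y$ has a point of continuity. *)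

theory Defs
  imports "HOL-Analysis.Analysis"
begin

locale pretree =
  fixes X :: "'a set" and R :: "'a \<Rightarrow> 'a \<Rightarrow> 'a \<Rightarrow> bool"
  assumes rel_on: "R a b c \<Longrightarrow> a \<in> X \<and> b \<in> X \<and> c \<in> X"
    and B1: "R a b c \<Longrightarrow> R c b a"
    and B2: "\<lbrakk>a \<in> X; b \<in> X; c \<in> X\<rbrakk> \<Longrightarrow> R a b c \<and> R a c b \<longleftrightarrow> b = c"
    and B3: "\<lbrakk>R a b c; d \<in> X\<rbrakk> \<Longrightarrow> R a b d \<or> R d b c"

definition pretree_interval :: "'a set \<Rightarrow> ('a \<Rightarrow> 'a \<Rightarrow> 'a \<Rightarrow> bool) \<Rightarrow> 'a \<Rightarrow> 'a \<Rightarrow> 'a set" where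
  "pretree_interval X R u v = {x \<in> X. R u x v}"

locale median_pretree = pretree +
  assumes median: "\<lbrakk>a \<in> X; b \<in> X; c \<in> X\<rbrakk> \<Longrightarrow>
    pretree_interval X R a b \<inter> pretree_interval X R a c \<inter> pretree_interval X R b c \<noteq> {}"

text \<open>\<open>shadow X R u v\<close> is $S^v_u$.\<close>

definition shadow :: "'a set \<Rightarrow> ('a \<Rightarrow> 'a \<Rightarrow> 'a \<Rightarrow> bool) \<Rightarrow> 'a \<Rightarrow> 'a \<Rightarrow> 'a set" where
  "shadow X R u v = {x \<in> X. u \<in> pretree_interval X R x v}"

text \<open>The set \<open>X\<close> itself (the empty intersection of subbasic open sets) is inserted
  because \<^const>\<open>topology_generated_by\<close> takes the union of the given family as the
  underlying space; without it a one-point pretree would receive the empty space.\<close>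

definition shadow_topology :: "'a set \<Rightarrow> ('a \<Rightarrow> 'a \<Rightarrow> 'a \<Rightarrow> bool) \<Rightarrow> 'a topology" where
  "shadow_topology X R = topology_generated_by
     (insert X {X - shadow X R u v |u v. u \<in> X \<and> v \<in> X \<and> u \<noteq> v})"

lemma topspace_shadow_topology [simp]: "topspace (shadow_topology X R) = X"
  unfolding shadow_topology_def topology_generated_by_topspace by auto

definition pretree_monotone :: "'a set \<Rightarrow> ('a \<Rightarrow> 'a \<Rightarrow> 'a \<Rightarrow> bool) \<Rightarrow> ('a \<Rightarrow> real) \<Rightarrow> bool" where
  "pretree_monotone X R f \<longleftrightarrow>
     (\<forall>u\<in>X. \<forall>w\<in>X. \<forall>v\<in>X. R u w v \<longrightarrow> f w \<in> closed_segment (f u) (f v))"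

text \<open>For real functions on a compact Hausdorff space, fragmentability means the
  point of continuity property, which is what is recorded here.\<close>

definition fragmented :: "'a topology \<Rightarrow> ('a \<Rightarrow> real) \<Rightarrow> bool" where
  "fragmented T f \<longleftrightarrow>
     (\<forall>Y. closedin T Y \<and> Y \<noteq> {} \<longrightarrow>
        (\<exists>y\<in>Y. topcontinuous_at (subtopology T Y) euclideanreal f y))"

end

theory Submission
  imports Defs
begin

text \<open>
  Suppose that \<open>f\<close> has no point of continuity on the closed set \<open>Y\<close>. By Baire there are
  \<open>p < q\<close> and a nonempty relatively open subset \<open>S\<close> of \<open>Y\<close> in which both convex sets
  \<open>A = {f \<le> p}\<close> and \<open>B = {f \<ge> q}\<close> are dense. For a point \<open>u\<close>, the open branches at \<open>u\<close>
  partition the rest of the pretree. If two branches at \<open>u\<close> met \<open>S\<close>, then both would contain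
  points of \<open>A\<close> and of \<open>B\<close>, and \<open>u\<close> would lie in \<open>A \<inter> B = {}\<close> by convexity. So all of \<open>S\<close>,
  except possibly \<open>u\<close>, lies in one branch, whence every open set that meets \<open>S\<close> contains all
  but finitely many points of \<open>S\<close>. As the space is Hausdorff, \<open>S\<close> is finite, hence it has an
  isolated point, which again would lie in \<open>A \<inter> B\<close>.
\<close>

section \<open>Discontinuity and Baire category\<close>

text \<open>Values at distance at least some \<open>e\<close> from \<open>f y\<close> recur in every
  neighbourhood of \<open>y\<close>, always above or always below. Both \<open>p\<close> and
  \<open>q\<close> are chosen strictly between \<open>f y\<close> and that far level, so
  \<open>y\<close> itself witnesses one closure and the far points witness the other. Rationality
  keeps the pairs countable for Baire.\<close>

lemma not_topcontinuous_at_real_gap: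
  fixes f :: "'a \<Rightarrow> real"
  assumes y: "y \<in> topspace Z" and nc: "\<not> topcontinuous_at Z euclideanreal f y"
  obtains p q where "p \<in> \<rat>" "q \<in> \<rat>" "p < q"
    "y \<in> Z closure_of {x \<in> topspace Z. f x \<le> p}" "y \<in> Z closure_of {x \<in> topspace Z. q \<le> f x}"
proof -
  obtain V where V: "open V" "f y \<in> V"
    and out: "\<And>U. openin Z U \<Longrightarrow> y \<in> U \<Longrightarrow> \<exists>z\<in>U. f z \<notin> V"
    using y nc unfolding topcontinuous_at_def by auto
  obtain e where e: "e > 0" "ball (f y) e \<subseteq> V"
    using V openE by blast
  have far: "\<exists>z\<in>U. f y + e \<le> f z \<or> f z \<le> f y - e" if U: "openin Z U" "y \<in> U" for U
  proof -
    obtain z where z: "z \<in> U" "f z \<notin> V"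
      using out[OF U] by blast
    then have "\<not> dist (f y) (f z) < e"
      using e by auto
    then show ?thesis
      using z(1) by (auto simp: dist_real_def intro!: bexI[of _ z])
  qed
  \<comment> \<open>If \<open>U1\<close> has no far value above and \<open>U2\<close> none below,
    then \<open>U1 \<inter> U2\<close> contradicts \<open>far\<close>.\<close>
  consider (hi) "\<And>U. openin Z U \<Longrightarrow> y \<in> U \<Longrightarrow> \<exists>z\<in>U. f y + e \<le> f z"
    | (lo) "\<And>U. openin Z U \<Longrightarrow> y \<in> U \<Longrightarrow> \<exists>z\<in>U. f z \<le> f y - e"
  proof (rule ccontr)
    assume "\<not> thesis"
    with hi lo obtain U1 U2 where U: "openin Z U1" "y \<in> U1" "\<not> (\<exists>z\<in>U1. f y + e \<le> f z)"
      "openin Z U2" "y \<in> U2" "\<not> (\<exists>z\<in>U2. f z \<le> f y - e)"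
      by blast
    then show False
      using far[of "U1 \<inter> U2"] by auto
  qed
  then show thesis
  proof cases
    case hi
    obtain p where p: "p \<in> \<rat>" "f y < p" "p < f y + e"
      using Rats_dense_in_real[of "f y" "f y + e"] e by auto
    obtain q where q: "q \<in> \<rat>" "p < q" "q < f y + e"
      using Rats_dense_in_real[of p "f y + e"] p by auto
    show thesis
    proof (rule that[OF p(1) q(1,2)])
      show "y \<in> Z closure_of {x \<in> topspace Z. f x \<le> p}"
        using y p by (auto simp: in_closure_of)
      show "y \<in> Z closure_of {x \<in> topspace Z. q \<le> f x}"
        using y q(3) hi openin_subset unfolding in_closure_of by fastforce
    qed
  next
    case lo
    obtain q where q: "q \<in> \<rat>" "f y - e < q" "q < f y"
      using Rats_dense_in_real[of "f y - e" "f y"] e by auto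
    obtain p where p: "p \<in> \<rat>" "f y - e < p" "p < q"
      using Rats_dense_in_real[of "f y - e" q] q by auto
    show thesis
    proof (rule that[OF p(1) q(1) p(3)])
      show "y \<in> Z closure_of {x \<in> topspace Z. q \<le> f x}"
        using y q by (auto simp: in_closure_of)
      show "y \<in> Z closure_of {x \<in> topspace Z. f x \<le> p}"
        using y p(2) lo openin_subset unfolding in_closure_of by fastforce
    qed
  qed
qed

text \<open>Each point lies in one of the countably many closed sets \<open>C (p, q)\<close> with
  rational \<open>p < q\<close>, so by Baire one of them has nonempty interior; that interior is
  \<open>S\<close>.\<close>

lemma nowhere_continuous_uniform_gap:
  fixes f :: "'a \<Rightarrow> real"
  assumes "locally_compact_space Z" "regular_space Z" and ne: "topspace Z \<noteq> {}"
    and nc: "\<And>y. y \<in> topspace Z \<Longrightarrow> \<not> topcontinuous_at Z euclideanreal f y"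
  obtains p q S where "p < q" "openin Z S" "S \<noteq> {}"
    "S \<subseteq> Z closure_of {x \<in> topspace Z. f x \<le> p}" "S \<subseteq> Z closure_of {x \<in> topspace Z. q \<le> f x}"
proof -
  define C where
    "C = (\<lambda>(p, q). Z closure_of {x \<in> topspace Z. f x \<le> p} \<inter> Z closure_of {x \<in> topspace Z. q \<le> f x})"
  define \<G> where "\<G> = C ` {(p, q). p \<in> \<rat> \<and> q \<in> \<rat> \<and> p < q}"
  have "countable {(p, q). p \<in> \<rat> \<and> q \<in> \<rat> \<and> p < (q::real)}"
    by (rule countable_subset[of _ "\<rat> \<times> \<rat>"]) (auto simp: countable_rat)
  then have cnt: "countable \<G>"
    by (simp add: \<G>_def)
  have "\<Union>\<G> = topspace Z"
  proof
    show "\<Union>\<G> \<subseteq> topspace Z"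
      using closure_of_subset_topspace by (fastforce simp: \<G>_def C_def)
    show "topspace Z \<subseteq> \<Union>\<G>"
    proof
      fix y assume y: "y \<in> topspace Z"
      obtain p q where "p \<in> \<rat>" "q \<in> \<rat>" "p < q" "y \<in> C (p, q)"
        by (rule not_topcontinuous_at_real_gap[OF y nc[OF y]]) (simp add: C_def)
      then show "y \<in> \<Union>\<G>"
        unfolding \<G>_def by blast
    qed
  qed
  then have "Z interior_of \<Union>\<G> \<noteq> {}"
    using ne by simp
  moreover have "closedin Z G" if "G \<in> \<G>" for G
    using that by (auto simp: \<G>_def C_def)
  ultimately obtain G where "G \<in> \<G>" and G: "Z interior_of G \<noteq> {}"
    using Baire_category_alt[of Z \<G>] assms(1,2) cnt by blast
  then obtain p q where pq: "p < q" "G = C (p, q)"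
    by (auto simp: \<G>_def)
  show thesis
  proof (rule that[OF pq(1) openin_interior_of G])
    show "Z interior_of G \<subseteq> Z closure_of {x \<in> topspace Z. f x \<le> p}"
      "Z interior_of G \<subseteq> Z closure_of {x \<in> topspace Z. q \<le> f x}"
      using interior_of_subset[of Z G] by (auto simp: pq C_def)
  qed
qed

section \<open>Branches and convex sets in a pretree\<close>

context pretree
begin

lemma rel_right [simp]: "a \<in> X \<Longrightarrow> b \<in> X \<Longrightarrow> R a b b"
  using B2[of a b b] by simp

lemma rel_left [simp]: "a \<in> X \<Longrightarrow> b \<in> X \<Longrightarrow> R a a b"
  using B1 rel_right by blast

lemma rel_same: "R a b a \<Longrightarrow> b = a"
  using B2[of a b a] rel_on by (metis rel_left)

lemma mem_shadow: "x \<in> shadow X R u v \<longleftrightarrow> R x u v"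
  using rel_on by (auto simp: shadow_def pretree_interval_def)

lemma openin_branch:
  "u \<in> X \<Longrightarrow> v \<in> X \<Longrightarrow> u \<noteq> v \<Longrightarrow> openin (shadow_topology X R) (X - shadow X R u v)"
  unfolding shadow_topology_def by (rule topology_generated_by_Basis) blast

text \<open>Here \<open>u\<close> separates \<open>y\<close> from \<open>v\<close>, with
  \<open>a1\<close> in the branch at \<open>u\<close> towards \<open>v\<close> and \<open>a2\<close>
  in the branch towards \<open>y\<close>. Replacing \<open>v\<close> by \<open>a1\<close> and then
  \<open>y\<close> by \<open>a2\<close>, each time by \<open>B3\<close>, keeps \<open>u\<close> in
  between.\<close>

lemma between_branches:
  assumes y: "R y u v" and a1: "a1 \<in> X" "\<not> R a1 u v" and a2: "a2 \<in> X" "\<not> R a2 u y"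
  shows "R a1 u a2"
  using B3[OF y a1(1)] B3[of y u a1 a2] a1 a2 B1 by blast

lemma monotone_sublevel_convex:
  assumes "pretree_monotone X R f" "R u w v" "f u \<le> p" "f v \<le> p"
  shows "f w \<le> (p::real)"
  using assms rel_on unfolding pretree_monotone_def closed_segment_eq_real_ivl
  by (fastforce split: if_splits)

lemma monotone_superlevel_convex:
  assumes "pretree_monotone X R f" "R u w v" "p \<le> f u" "p \<le> f v"
  shows "(p::real) \<le> f w"
  using assms rel_on unfolding pretree_monotone_def closed_segment_eq_real_ivl
  by (fastforce split: if_splits)

text \<open>Induction on the generation of \<open>W\<close>: an intersection unites two finite
  remainders, a union contains a member that meets \<open>S\<close>, and a subbasic branch at
  \<open>u\<close> can miss no point of \<open>S\<close> except \<open>u\<close>.\<close>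

lemma open_cofinite_if_disjoint_convex_dense:
  assumes S: "S \<subseteq> X" and disj: "A \<inter> B = {}"
    and convA: "\<And>u w v. u \<in> A \<Longrightarrow> v \<in> A \<Longrightarrow> R u w v \<Longrightarrow> w \<in> A"
    and convB: "\<And>u w v. u \<in> B \<Longrightarrow> v \<in> B \<Longrightarrow> R u w v \<Longrightarrow> w \<in> B"
    and denseA: "\<And>W. openin (shadow_topology X R) W \<Longrightarrow> W \<inter> S \<noteq> {} \<Longrightarrow> W \<inter> S \<inter> A \<noteq> {}"
    and denseB: "\<And>W. openin (shadow_topology X R) W \<Longrightarrow> W \<inter> S \<noteq> {} \<Longrightarrow> W \<inter> S \<inter> B \<noteq> {}"
    and W: "openin (shadow_topology X R) W" "W \<inter> S \<noteq> {}"
  shows "finite (S - W)"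
proof -
  have "generate_topology_on
      (insert X {X - shadow X R u v |u v. u \<in> X \<and> v \<in> X \<and> u \<noteq> v}) W"
    using W(1) unfolding shadow_topology_def by (rule openin_topology_generated_by)
  then show ?thesis
    using W(2)
  proof (induction W)
    case Empty
    then show ?case by simp
  next
    case (Int a b)
    then have "finite ((S - a) \<union> (S - b))"
      by blast
    then show ?case
      by (simp add: Diff_Int)
  next
    case (UN K)
    then obtain k where "k \<in> K" "finite (S - k)"
      by blast
    then show ?case
      by (meson Diff_mono Union_upper finite_subset order_refl)
  next
    case (Basis W)
    then consider "W = X" | u v where "W = X - shadow X R u v" "u \<in> X" "v \<in> X" "u \<noteq> v"
      by blast
    then show ?case
    proof cases
      case 1
      then show ?thesis
        using S by (simp add: Diff_eq_empty_iff[THEN iffD2])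
    next
      case W: 2
      have "S - W \<subseteq> {u}"
      proof
        fix y assume y: "y \<in> S - W"
        then have yuv: "R y u v" and yX: "y \<in> X"
          using S W by (auto simp: mem_shadow)
        show "y \<in> {u}"
        proof (rule ccontr)
          assume "y \<notin> {u}"
          then have yu: "u \<noteq> y"
            by auto
          \<comment> \<open>\<open>W'\<close> is the branch at \<open>u\<close> containing
            \<open>y\<close>. Both \<open>W\<close> and \<open>W'\<close> meet \<open>S\<close>, so
            density puts points of \<open>A\<close> and of \<open>B\<close> in each, and convexity
            forces \<open>u\<close> into both sets.\<close>
          define W' where "W' = X - shadow X R u y"
          have "openin (shadow_topology X R) W" "openin (shadow_topology X R) W'"
            using W yX yu by (auto simp: W'_def intro: openin_branch)
          moreover have "W' \<inter> S \<noteq> {}"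
            using y yX yu rel_same by (auto simp: W'_def mem_shadow)
          ultimately obtain a1 a2 b1 b2 where
            "a1 \<in> W \<inter> A" "a2 \<in> W' \<inter> A" "b1 \<in> W \<inter> B" "b2 \<in> W' \<inter> B"
            using denseA[of W] denseA[of W'] denseB[of W] denseB[of W'] Basis.prems by blast
          then have "u \<in> A" "u \<in> B"
            using between_branches[OF yuv] convA[of a1 a2 u] convB[of b1 b2 u]
            by (auto simp: W W'_def mem_shadow)
          then show False
            using disj by blast
        qed
      qed
      then show ?thesis
        using finite_subset by blast
    qed
  qed
qed

text \<open>Disjoint neighbourhoods of two points of \<open>S\<close> both omit only finitely many
  points of \<open>S\<close>, so \<open>S\<close> is finite.\<close>

lemma no_disjoint_convex_dense:
  assumes haus: "Hausdorff_space (shadow_topology X R)"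
    and S: "S \<subseteq> X" "S \<noteq> {}" and disj: "A \<inter> B = {}"
    and convA: "\<And>u w v. u \<in> A \<Longrightarrow> v \<in> A \<Longrightarrow> R u w v \<Longrightarrow> w \<in> A"
    and convB: "\<And>u w v. u \<in> B \<Longrightarrow> v \<in> B \<Longrightarrow> R u w v \<Longrightarrow> w \<in> B"
    and denseA: "\<And>W. openin (shadow_topology X R) W \<Longrightarrow> W \<inter> S \<noteq> {} \<Longrightarrow> W \<inter> S \<inter> A \<noteq> {}"
    and denseB: "\<And>W. openin (shadow_topology X R) W \<Longrightarrow> W \<inter> S \<noteq> {} \<Longrightarrow> W \<inter> S \<inter> B \<noteq> {}"
  shows False
proof -
  let ?T = "shadow_topology X R"
  have "openin ?T X"
    using openin_topspace[of ?T] by simp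
  moreover have "X \<inter> S \<noteq> {}"
    using S by blast
  ultimately obtain a b where ab: "a \<in> S \<inter> A" "b \<in> S \<inter> B"
    using denseA[of X] denseB[of X] by blast
  then have "a \<in> X" "b \<in> X" "a \<noteq> b"
    using S disj by auto
  then obtain U V where UV: "openin ?T U" "openin ?T V" "a \<in> U" "b \<in> V" "disjnt U V"
    using haus unfolding Hausdorff_space_def by (metis topspace_shadow_topology)
  have cofinite: "finite (S - W)" if "openin ?T W" "W \<inter> S \<noteq> {}" for W
    by (rule open_cofinite_if_disjoint_convex_dense[OF S(1) disj convA convB denseA denseB that])
  have "finite ((S - U) \<union> (S - V))"
    using cofinite[of U] cofinite[of V] UV ab by blast
  then have "finite S"
    by (rule rev_finite_subset) (use UV(5) in \<open>auto simp: disjnt_iff\<close>)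
  then have "closedin ?T (S - {a})"
    using haus S by (intro closedin_Hausdorff_finite) auto
  \<comment> \<open>This open set isolates \<open>a\<close> in \<open>S\<close>, so density of
    \<open>B\<close> yields \<open>a \<in> B\<close>, although \<open>a \<in> A\<close>.\<close>
  then have "openin ?T (X - (S - {a}))"
    by (metis closedin_def topspace_shadow_topology)
  moreover have "(X - (S - {a})) \<inter> S = {a}"
    using ab S by auto
  ultimately have "a \<in> B"
    using denseB[of "X - (S - {a})"] by auto
  then show False
    using ab disj by blast
qed

theorem monotone_fragmented:
  fixes f :: "'a \<Rightarrow> real"
  assumes comp: "compact_space (shadow_topology X R)"
    and haus: "Hausdorff_space (shadow_topology X R)"
    and mono: "pretree_monotone X R f"
  shows "fragmented (shadow_topology X R) f"
  unfolding fragmented_def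
proof (intro allI impI, elim conjE, rule ccontr)
  let ?T = "shadow_topology X R"
  fix Y assume Y: "closedin ?T Y" "Y \<noteq> {}"
    and nc: "\<not> (\<exists>y\<in>Y. topcontinuous_at (subtopology ?T Y) euclideanreal f y)"
  have YX: "Y \<subseteq> X"
    using closedin_subset[OF Y(1)] by simp
  have top: "topspace (subtopology ?T Y) = Y"
    using YX by auto
  have "compact_space (subtopology ?T Y)"
    using closedin_compact_space[OF comp Y(1)] by (rule compact_space_subtopology)
  moreover have "Hausdorff_space (subtopology ?T Y)"
    using haus by (rule Hausdorff_space_subtopology)
  ultimately have lc: "locally_compact_space (subtopology ?T Y)" "regular_space (subtopology ?T Y)"
    by (auto intro: compact_imp_locally_compact_space compact_Hausdorff_imp_regular_space)
  obtain p q S where "p < q" and S: "openin (subtopology ?T Y) S" "S \<noteq> {}"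
    and clA: "S \<subseteq> subtopology ?T Y closure_of {x \<in> topspace (subtopology ?T Y). f x \<le> p}"
    and clB: "S \<subseteq> subtopology ?T Y closure_of {x \<in> topspace (subtopology ?T Y). q \<le> f x}"
  proof (rule nowhere_continuous_uniform_gap[OF lc])
    show "topspace (subtopology ?T Y) \<noteq> {}"
      using top Y(2) by simp
    show "\<not> topcontinuous_at (subtopology ?T Y) euclideanreal f y"
      if "y \<in> topspace (subtopology ?T Y)" for y
      using that nc top by blast
  qed
  \<comment> \<open>This turns the closure statements relative to \<open>Y\<close> into density
    tested by open sets of the whole space.\<close>
  have openS: "openin (subtopology ?T Y) (W \<inter> S)" if "openin ?T W" for W
  proof -
    have "W \<inter> S = (W \<inter> Y) \<inter> S"
      using openin_subset[OF S(1)] top by auto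
    then show ?thesis
      using openin_Int[OF openin_subtopology_Int[OF that] S(1)] by simp
  qed
  show False
  proof (rule no_disjoint_convex_dense[OF haus])
    show "S \<subseteq> X"
      using openin_subset[OF S(1)] top YX by auto
    show "S \<noteq> {}" by fact
    show "{x. f x \<le> p} \<inter> {x. q \<le> f x} = {}"
      using \<open>p < q\<close> by auto
    show "w \<in> {x. f x \<le> p}" if "u \<in> {x. f x \<le> p}" "v \<in> {x. f x \<le> p}" "R u w v" for u w v
      using monotone_sublevel_convex[OF mono] that by blast
    show "w \<in> {x. q \<le> f x}" if "u \<in> {x. q \<le> f x}" "v \<in> {x. q \<le> f x}" "R u w v" for u w v
      using monotone_superlevel_convex[OF mono] that by blast
    fix W assume W: "openin ?T W" "W \<inter> S \<noteq> {}"
    have meets: "W \<inter> S \<inter> D \<noteq> {}" if "S \<subseteq> subtopology ?T Y closure_of D" for D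
      using openin_Int_closure_of_eq_empty[OF openS[OF W(1)], of D] that W(2) by blast
    show "W \<inter> S \<inter> {x. f x \<le> p} \<noteq> {}"
      using meets[OF clA] by blast
    show "W \<inter> S \<inter> {x. q \<le> f x} \<noteq> {}"
      using meets[OF clB] by blast
  qed
qed

end

section \<open>Separation in median pretrees\<close>

text \<open>If some \<open>z\<close> lies strictly between \<open>x\<close> and \<open>y\<close>,
  the branches at \<open>z\<close> towards \<open>x\<close> and towards \<open>y\<close> separate
  them, being disjoint by \<open>B3\<close>. Otherwise the branch at \<open>y\<close> towards
  \<open>x\<close> and the branch at \<open>x\<close> towards \<open>y\<close> do.\<close>

lemma (in median_pretree) Hausdorff_shadow_topology:
  "Hausdorff_space (shadow_topology X R)"
  unfolding Hausdorff_space_def topspace_shadow_topology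
proof (intro allI impI, elim conjE)
  let ?T = "shadow_topology X R"
  fix x y assume xy: "x \<in> X" "y \<in> X" "x \<noteq> y"
  show "\<exists>U V. openin ?T U \<and> openin ?T V \<and> x \<in> U \<and> y \<in> V \<and> disjnt U V"
  proof (cases "\<exists>z. R x z y \<and> z \<noteq> x \<and> z \<noteq> y")
    case True
    then obtain z where z: "R x z y" "z \<noteq> x" "z \<noteq> y"
      by blast
    then have zX: "z \<in> X"
      using rel_on by blast
    have "disjnt (X - shadow X R z x) (X - shadow X R z y)"
      using B3[OF z(1)] B1 by (auto simp: disjnt_iff mem_shadow)
    moreover have "x \<in> X - shadow X R z x" "y \<in> X - shadow X R z y"
      using xy z rel_same by (auto simp: mem_shadow)
    ultimately show ?thesis
      using openin_branch[OF zX xy(1) z(2)] openin_branch[OF zX xy(2) z(3)] by blast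
  next
    case False
    \<comment> \<open>The median of \<open>p\<close>, \<open>x\<close>, \<open>y\<close> lies in the
      interval from \<open>x\<close> to \<open>y\<close>, which now consists of its endpoints
      only.\<close>
    have "R p x y \<or> R p y x" if "p \<in> X" for p
      using median[OF that xy(1,2)] False by (auto simp: pretree_interval_def)
    then have "disjnt (X - shadow X R y x) (X - shadow X R x y)"
      by (auto simp: disjnt_iff mem_shadow)
    moreover have "x \<in> X - shadow X R y x" "y \<in> X - shadow X R x y"
      using xy rel_same by (auto simp: mem_shadow)
    moreover have "openin ?T (X - shadow X R y x)" "openin ?T (X - shadow X R x y)"
      using xy by (auto intro: openin_branch)
    ultimately show ?thesis
      by blast
  qed
qed

text \<open>The second conjunct covers the example: a compact median pretree satisfies the
  hypotheses of the first.\<close>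

theorem theorem4p13:
  fixes X :: "'a set" and R :: "'a \<Rightarrow> 'a \<Rightarrow> 'a \<Rightarrow> bool"
  shows "(pretree X R \<and> compact_space (shadow_topology X R) \<and> Hausdorff_space (shadow_topology X R)
            \<longrightarrow> (\<forall>f :: 'a \<Rightarrow> real. pretree_monotone X R f \<longrightarrow> fragmented (shadow_topology X R) f))
       \<and> (median_pretree X R \<and> compact_space (shadow_topology X R)
            \<longrightarrow> Hausdorff_space (shadow_topology X R))"
  using pretree.monotone_fragmented median_pretree.Hausdorff_shadow_topology by blast

end
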